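(* Let $\alpha=\alpha(x,y,z,p,q)$ be a smooth function of involutive type, i.e. $\alpha_x+p\alpha_z-\alpha(\alpha_y+q\alpha_z)=0$ on its (open) domain, let $\mathcal I=\{\omega_0,\Psi\}_{\mathrm{diff}}$ with $\omega_0=dz-p\,dx-q\,dy$ and $\Psi=dp-\alpha\,dq$, and let $p_0$ be a point of the domain. Then: (1) If $1+x(\alpha_y+q\alpha_z)\neq 0$ at $p_0$, then $$\mathrm{Ch}(\mathcal I)=\{d(y+\alpha x)=d(z-px-qy)=dp=dq=0\}\quad\text{at }p_0,$$ that is, $y+\alpha x$, $z-px-qy$, $p$, $q$ are independent first integrals of $\mathrm{Ch}(\mathcal I)$ (at $p_0$). (2) If $1+x(\alpha_y+q\alpha_z)=0$ at $p_0$, then $$\mathrm{Ch}(\mathcal I)=\{d\alpha=d(z-px-qy)=dp=dq=0\}\quad\text{at }p_0,$$ that is, $\alpha$, $z-px-qy$, $p$, $q$ are independent first integrals of $\mathrm{Ch}(\mathcal I)$ (at $p_0$).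
   Context: All objects are $C^\infty$. $J^0(2,1)$ is a three-dimensional manifold and $J^1(2,1)=PT^*J^0(2,1)$ is its projective cotangent bundle with its natural contact form $\omega_0$; $(x,y,z,p,q)$ is a canonical local coordinate system, i.e. $\omega_0=dz-p\,dx-q\,dy$. We work on the domain of this coordinate system, so $\alpha$ is a function on an open subset of $\mathbb R^5$. For differential forms $\omega_1,\dots,\omega_r$ on a manifold $M$, $\{\omega_1,\dots,\omega_r\}_{\mathrm{alg}}$ is the ideal of $\Omega^*(M)$ they generate and $\{\omega_1,\dots,\omega_r\}_{\mathrm{diff}}=\{\omega_1,\dots,\omega_r,d\omega_1,\dots,d\omega_r\}_{\mathrm{alg}}$. The Cauchy characteristic system of an ideal $\mathcal J$ is $\mathrm{Ch}(\mathcal J)=\{X\in TM : \iota_X(\mathcal J)\subset\mathcal J\}$, where $\iota_X$ is the interior product; for a tangent vector $X\in T_mM$ this is read pointwise, i.e. $\iota_X(\mathcal J_m)\subset\mathcal J_m$, where $\mathcal J_m\subset\bigwedge T_m^*M$ is the ideal of values of $\mathcal J$ at $m$. An expression $\{\theta_1=\dots=\theta_k=0\}$ denotes the set of tangent vectors annihilated by the 1-forms $\theta_1,\dots,\theta_k$. A function $f$ is a first integral of $\mathrm{Ch}(\mathcal J)$ if $df$ annihilates $\mathrm{Ch}(\mathcal J)$; first integrals are independent if their differentials are linearly independent. *)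

theory Defs
  imports "HOL-Analysis.Analysis"
begin

section \<open>Smooth functions\<close>

primrec Ck_on :: "nat \<Rightarrow> 'a::real_normed_vector set \<Rightarrow> ('a \<Rightarrow> real) \<Rightarrow> bool" where
  "Ck_on 0 U f \<longleftrightarrow> continuous_on U f"
| "Ck_on (Suc k) U f \<longleftrightarrow>
     (\<forall>x\<in>U. f differentiable (at x)) \<and>
     (\<forall>v. Ck_on k U (\<lambda>x. frechet_derivative f (at x) v))"

definition smooth_on :: "'a::real_normed_vector set \<Rightarrow> ('a \<Rightarrow> real) \<Rightarrow> bool" where
  "smooth_on U f \<longleftrightarrow> (\<forall>k. Ck_on k U f)"


section \<open>Exterior algebra of a vector space\<close>

text \<open>
  An element of the full exterior algebra of the dual of a finite-dimensional space is encoded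
  as one function on lists of vectors: its component of degree \<open>k\<close> is the restriction to the
  lists of length \<open>k\<close>.  So inhomogeneous elements are included; an alternating multilinear
  function vanishes on lists longer than the dimension, hence all sums of components are finite.
\<close>

type_synonym 'a covec = "'a list \<Rightarrow> real"

definition alternating_form :: "'a::real_vector covec \<Rightarrow> bool" where
  "alternating_form a \<longleftrightarrow>
     (\<forall>us ws. linear (\<lambda>v. a (us @ v # ws))) \<and> (\<forall>vs. \<not> distinct vs \<longrightarrow> a vs = 0)"

text \<open>
  The wedge product is the sum over shuffles, without factorials, so that
  \<open>(\<theta> \<and> \<eta>)(v, w) = \<theta>(v) \<eta>(w) - \<theta>(w) \<eta>(v)\<close> for 1-forms.  A shuffle is given by the
  set \<open>I\<close> of positions whose arguments go to the first factor; its sign counts the inversions.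
\<close>

definition wedge :: "'a covec \<Rightarrow> 'a covec \<Rightarrow> 'a covec" where
  "wedge a b vs =
     (\<Sum>I\<in>Pow {..<length vs}.
        (-1) ^ card {(i, j). i \<in> I \<and> j \<in> {..<length vs} - I \<and> j < i} *
        a (nths vs I) * b (nths vs (- I)))"

definition interior_product :: "'a \<Rightarrow> 'a covec \<Rightarrow> 'a covec" where
  "interior_product X a = (\<lambda>vs. a (X # vs))"


section \<open>Differential forms on an open subset of a normed space\<close>

type_synonym 'a dform = "'a \<Rightarrow> 'a covec"

text \<open>
  \<open>Omega U\<close> is the algebra of smooth forms on \<open>U\<close>.  Forms are total functions of the base point;
  their values outside \<open>U\<close> are arbitrary and never used.
\<close>

definition Omega :: "'a::real_normed_vector set \<Rightarrow> 'a dform set" where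
  "Omega U = {\<omega>. (\<forall>x\<in>U. alternating_form (\<omega> x)) \<and> (\<forall>vs. smooth_on U (\<lambda>x. \<omega> x vs))}"

definition wedge_form :: "'a dform \<Rightarrow> 'a dform \<Rightarrow> 'a dform" where
  "wedge_form \<omega> \<eta> = (\<lambda>x. wedge (\<omega> x) (\<eta> x))"

text \<open>
  Exterior derivative, with the directional derivatives taken for constant vector fields:
  \<open>d\<omega>(v\<^sub>0, \<dots>, v\<^sub>k) = \<Sum>\<^sub>i (-1)\<^sup>i v\<^sub>i(\<omega>(v\<^sub>0, \<dots>, v\<^sub>k without v\<^sub>i))\<close>.
\<close>

definition ext_d :: "'a::real_normed_vector dform \<Rightarrow> 'a dform" where
  "ext_d \<omega> = (\<lambda>x vs. \<Sum>i<length vs.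
     (-1) ^ i * frechet_derivative (\<lambda>y. \<omega> y (take i vs @ drop (Suc i) vs)) (at x) (vs ! i))"

definition fun_form :: "('a \<Rightarrow> real) \<Rightarrow> 'a dform" where
  "fun_form f = (\<lambda>x vs. if vs = [] then f x else 0)"

abbreviation dfun :: "('a::real_normed_vector \<Rightarrow> real) \<Rightarrow> 'a dform" where
  "dfun f \<equiv> ext_d (fun_form f)"


section \<open>Ideals of forms and Cauchy characteristics\<close>

text \<open>The smallest two-sided ideal of \<open>Omega U\<close> containing the given forms.\<close>

inductive_set alg_ideal :: "'a::real_normed_vector set \<Rightarrow> 'a dform set \<Rightarrow> 'a dform set"
  for U :: "'a set" and S :: "'a dform set" where
  generator: "\<omega> \<in> S \<Longrightarrow> \<omega> \<in> alg_ideal U S"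
| zero: "(\<lambda>x vs. 0) \<in> alg_ideal U S"
| add: "\<omega> \<in> alg_ideal U S \<Longrightarrow> \<eta> \<in> alg_ideal U S \<Longrightarrow> (\<lambda>x vs. \<omega> x vs + \<eta> x vs) \<in> alg_ideal U S"
| wedge_left: "\<beta> \<in> Omega U \<Longrightarrow> \<omega> \<in> alg_ideal U S \<Longrightarrow> wedge_form \<beta> \<omega> \<in> alg_ideal U S"
| wedge_right: "\<beta> \<in> Omega U \<Longrightarrow> \<omega> \<in> alg_ideal U S \<Longrightarrow> wedge_form \<omega> \<beta> \<in> alg_ideal U S"

definition diff_ideal :: "'a::real_normed_vector set \<Rightarrow> 'a dform set \<Rightarrow> 'a dform set" where
  "diff_ideal U S = alg_ideal U (S \<union> ext_d ` S)"

definition values_at :: "'a dform set \<Rightarrow> 'a \<Rightarrow> 'a covec set" where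
  "values_at J m = (\<lambda>\<omega>. \<omega> m) ` J"

text \<open>The fibre at \<open>m\<close> of the Cauchy characteristic system, as a set of tangent vectors.\<close>

definition Ch_at :: "'a dform set \<Rightarrow> 'a \<Rightarrow> 'a set" where
  "Ch_at J m = {X. interior_product X ` values_at J m \<subseteq> values_at J m}"

text \<open>The set \<open>{\<theta> = 0 for all \<theta> in \<Theta>}\<close> of tangent vectors at \<open>m\<close>, for a set of 1-forms.\<close>

definition annihilated_at :: "'a dform set \<Rightarrow> 'a \<Rightarrow> 'a set" where
  "annihilated_at \<Theta> m = {X. \<forall>\<theta>\<in>\<Theta>. \<theta> m [X] = 0}"

definition first_integral_at ::
    "'a::real_normed_vector dform set \<Rightarrow> 'a \<Rightarrow> ('a \<Rightarrow> real) \<Rightarrow> bool" where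
  "first_integral_at J m f \<longleftrightarrow> (\<forall>X\<in>Ch_at J m. dfun f m [X] = 0)"

definition independent_at :: "'a::real_normed_vector \<Rightarrow> ('a \<Rightarrow> real) list \<Rightarrow> bool" where
  "independent_at m fs \<longleftrightarrow>
     (\<forall>c :: nat \<Rightarrow> real.
        (\<forall>X. (\<Sum>i<length fs. c i * dfun (fs ! i) m [X]) = 0) \<longrightarrow> (\<forall>i<length fs. c i = 0))"

definition independent_first_integrals_at ::
    "'a::real_normed_vector dform set \<Rightarrow> 'a \<Rightarrow> ('a \<Rightarrow> real) list \<Rightarrow> bool" where
  "independent_first_integrals_at J m fs \<longleftrightarrow>
     (\<forall>f\<in>set fs. first_integral_at J m f) \<and> independent_at m fs"


section \<open>Canonical coordinates on \<open>J\<^sup>1(2,1)\<close>\<close>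

text \<open>
  The domain of a canonical coordinate system is identified with an open subset of \<open>real ^ 5\<close>,
  the coordinates being ordered as \<open>(x, y, z, p, q)\<close>.
\<close>

abbreviation X_coord :: "real ^ 5 \<Rightarrow> real" where "X_coord m \<equiv> m $ 1"
abbreviation Y_coord :: "real ^ 5 \<Rightarrow> real" where "Y_coord m \<equiv> m $ 2"
abbreviation Z_coord :: "real ^ 5 \<Rightarrow> real" where "Z_coord m \<equiv> m $ 3"
abbreviation P_coord :: "real ^ 5 \<Rightarrow> real" where "P_coord m \<equiv> m $ 4"
abbreviation Q_coord :: "real ^ 5 \<Rightarrow> real" where "Q_coord m \<equiv> m $ 5"

definition partial :: "5 \<Rightarrow> (real ^ 5 \<Rightarrow> real) \<Rightarrow> real ^ 5 \<Rightarrow> real" where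
  "partial i f m = frechet_derivative f (at m) (axis i 1)"

abbreviation D_x :: "(real ^ 5 \<Rightarrow> real) \<Rightarrow> real ^ 5 \<Rightarrow> real" where "D_x \<equiv> partial 1"
abbreviation D_y :: "(real ^ 5 \<Rightarrow> real) \<Rightarrow> real ^ 5 \<Rightarrow> real" where "D_y \<equiv> partial 2"
abbreviation D_z :: "(real ^ 5 \<Rightarrow> real) \<Rightarrow> real ^ 5 \<Rightarrow> real" where "D_z \<equiv> partial 3"

definition involutive_type :: "(real ^ 5) set \<Rightarrow> (real ^ 5 \<Rightarrow> real) \<Rightarrow> bool" where
  "involutive_type U \<alpha> \<longleftrightarrow>
     (\<forall>m\<in>U. D_x \<alpha> m + P_coord m * D_z \<alpha> m
              - \<alpha> m * (D_y \<alpha> m + Q_coord m * D_z \<alpha> m) = 0)"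

definition omega0 :: "(real ^ 5) dform" where
  "omega0 = (\<lambda>m vs. dfun Z_coord m vs - P_coord m * dfun X_coord m vs
                      - Q_coord m * dfun Y_coord m vs)"

definition Psi :: "(real ^ 5 \<Rightarrow> real) \<Rightarrow> (real ^ 5) dform" where
  "Psi \<alpha> = (\<lambda>m vs. dfun P_coord m vs - \<alpha> m * dfun Q_coord m vs)"

end

theory Submission
  imports Defs
begin

text \<open>
  In each fibre, contraction with \<open>X\<close> is an antiderivation, so it preserves the ideal iff it maps
  the four generators \<open>\<omega>\<^sub>0\<close>, \<open>\<Psi>\<close>, \<open>d\<omega>\<^sub>0 = dx \<and> dp + dy \<and> dq\<close>, \<open>d\<Psi> = - d\<alpha> \<and> dq\<close> into it.
  Elements of the ideal have no part of degree 0, and their part of degree 1 vanishes on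
  \<open>ker \<omega>\<^sub>0 \<inter> ker \<Psi>\<close>; applied to the contractions of \<open>\<omega>\<^sub>0\<close>, \<open>\<Psi>\<close> and \<open>d\<omega>\<^sub>0\<close>, this forces
  \<open>\<omega>\<^sub>0(X) = dp(X) = dq(X) = (\<alpha> dx + dy)(X) = 0\<close>.  Conversely, for such \<open>X\<close> the contraction of
  \<open>d\<omega>\<^sub>0\<close> is \<open>dx(X) \<Psi>\<close>, and that of \<open>d\<Psi>\<close> is 0 because involutivity gives
  \<open>d\<alpha> \<equiv> B (\<alpha> dx + dy)\<close> modulo \<open>\<omega>\<^sub>0, dp, dq\<close>, where \<open>B = \<alpha>\<^sub>y + q \<alpha>\<^sub>z\<close>.  Modulo the same forms,
  \<open>d(z - p x - q y) \<equiv> 0\<close> and \<open>d(y + \<alpha> x) \<equiv> (1 + x B) (\<alpha> dx + dy)\<close>; when the last factor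
  vanishes, \<open>B \<noteq> 0\<close> and \<open>\<alpha>\<close> replaces \<open>y + \<alpha> x\<close>.
\<close>

section \<open>Coordinates and partial derivatives on \<open>real ^ 5\<close>\<close>

lemma exhaust_5: "i = 1 \<or> i = 2 \<or> i = 3 \<or> i = 4 \<or> i = 5" for i :: 5
proof (induct i)
  case (of_int z)
  \<comment> \<open>The type \<open>5\<close> consists of residues modulo 5, so the representative 0
    is the index 5.\<close>
  then have "z = 0 \<or> z = 1 \<or> z = 2 \<or> z = 3 \<or> z = 4" by fastforce
  then show ?case by auto
qed

lemma UNIV_5: "UNIV = {1, 2, 3, 4, 5 :: 5}"
  using exhaust_5 by auto

lemma sum_5: "sum f (UNIV :: 5 set) = f 1 + f 2 + f 3 + f 4 + f 5"
  unfolding UNIV_5 by (simp add: add.assoc)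

lemma frechet_derivative_partial_expansion:
  fixes f :: "real ^ 5 \<Rightarrow> real"
  assumes "f differentiable (at m)"
  shows "frechet_derivative f (at m) v = (\<Sum>i\<in>UNIV. v $ i * partial i f m)"
proof -
  interpret linear "frechet_derivative f (at m)"
    using assms by (rule linear_frechet_derivative)
  have "frechet_derivative f (at m) (\<Sum>i\<in>UNIV. v $ i *\<^sub>R axis i 1)
          = (\<Sum>i\<in>UNIV. v $ i * partial i f m)"
    by (simp add: sum scaleR partial_def)
  then show ?thesis by (simp add: basis_expansion flip: scalar_mult_eq_scaleR)
qed

section \<open>Ideals in a single fibre\<close>

text \<open>The fibrewise counterpart of \<open>alg_ideal\<close>: coefficients are arbitrary
  alternating forms at one point, so the condition in \<open>Ch_at\<close> becomes linear
  algebra.\<close>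

inductive_set covec_ideal :: "'a::real_vector covec set \<Rightarrow> 'a covec set" for G where
  generator: "a \<in> G \<Longrightarrow> a \<in> covec_ideal G"
| zero: "(\<lambda>vs. 0) \<in> covec_ideal G"
| add: "a \<in> covec_ideal G \<Longrightarrow> b \<in> covec_ideal G \<Longrightarrow> (\<lambda>vs. a vs + b vs) \<in> covec_ideal G"
| wedge_left: "alternating_form b \<Longrightarrow> a \<in> covec_ideal G \<Longrightarrow> wedge b a \<in> covec_ideal G"
| wedge_right: "alternating_form b \<Longrightarrow> a \<in> covec_ideal G \<Longrightarrow> wedge a b \<in> covec_ideal G"

lemma Ck_on_const: "Ck_on k U (\<lambda>x. c)"
  by (induction k arbitrary: c) auto

lemma const_form_in_Omega: "alternating_form a \<Longrightarrow> (\<lambda>x. a) \<in> Omega U"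
  by (simp add: Omega_def smooth_on_def Ck_on_const)

text \<open>Evaluation at \<open>m\<close> carries each closure rule of \<open>alg_ideal\<close> to
  the same rule in the fibre. Conversely, a fibre coefficient extends to a constant form, which is
  smooth, so every element of the fibre ideal is the value of some form in the ideal.\<close>

lemma values_at_alg_ideal:
  assumes "m \<in> U"
  shows "values_at (alg_ideal U S) m = covec_ideal (values_at S m)"
proof
  have "\<omega> m \<in> covec_ideal (values_at S m)" if "\<omega> \<in> alg_ideal U S" for \<omega>
    using that
  proof induction
    case (generator \<omega>)
    then show ?case by (auto simp: values_at_def intro: covec_ideal.generator)
  next
    case (wedge_left \<beta> \<omega>)
    then show ?case
      using assms by (auto simp: wedge_form_def Omega_def intro: covec_ideal.wedge_left)
  next
    case (wedge_right \<beta> \<omega>)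
    then show ?case
      using assms by (auto simp: wedge_form_def Omega_def intro: covec_ideal.wedge_right)
  qed (auto intro: covec_ideal.intros)
  then show "values_at (alg_ideal U S) m \<subseteq> covec_ideal (values_at S m)"
    by (auto simp: values_at_def)
next
  have "\<exists>\<omega>\<in>alg_ideal U S. \<omega> m = a" if "a \<in> covec_ideal (values_at S m)" for a
    using that
  proof induction
    case (generator a)
    then show ?case by (auto simp: values_at_def intro: alg_ideal.generator)
  next
    case zero
    show ?case by (rule bexI[OF _ alg_ideal.zero]) simp
  next
    case (add a b)
    then obtain \<omega> \<eta> where "\<omega> \<in> alg_ideal U S" "\<eta> \<in> alg_ideal U S" "\<omega> m = a" "\<eta> m = b"
      by blast
    then show ?case by (intro bexI[OF _ alg_ideal.add[of \<omega> U S \<eta>]]) auto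
  next
    case (wedge_left b a)
    then obtain \<omega> where "\<omega> \<in> alg_ideal U S" "\<omega> m = a" by blast
    then show ?case
      using alg_ideal.wedge_left[OF const_form_in_Omega[OF wedge_left(1)]]
      by (intro bexI[of _ "wedge_form (\<lambda>x. b) \<omega>"]) (auto simp: wedge_form_def)
  next
    case (wedge_right b a)
    then obtain \<omega> where "\<omega> \<in> alg_ideal U S" "\<omega> m = a" by blast
    then show ?case
      using alg_ideal.wedge_right[OF const_form_in_Omega[OF wedge_right(1)]]
      by (intro bexI[of _ "wedge_form \<omega> (\<lambda>x. b)"]) (auto simp: wedge_form_def)
  qed
  then show "covec_ideal (values_at S m) \<subseteq> values_at (alg_ideal U S) m"
    by (auto simp: values_at_def)
qed

section \<open>Contraction as an antiderivation of the wedge product\<close>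

text \<open>Supplies the sign of the antiderivation rule for inhomogeneous elements, where no single
  degree can be put into the exponent.\<close>

definition grade_involution :: "'a covec \<Rightarrow> 'a covec" where
  "grade_involution a = (\<lambda>vs. (-1) ^ length vs * a vs)"

lemma alternating_form_grade_involution:
  "alternating_form a \<Longrightarrow> alternating_form (grade_involution a)"
  by (auto simp: alternating_form_def grade_involution_def linear_iff algebra_simps)

lemma alternating_form_interior_product:
  assumes "alternating_form a"
  shows "alternating_form (interior_product X a)"
proof -
  have "linear (\<lambda>v. a ((X # us) @ v # ws))" for us ws
    using assms unfolding alternating_form_def by blast
  then show ?thesis
    using assms by (auto simp: alternating_form_def interior_product_def)
qed

lemma length_nths_Compl: "length (nths vs I) + length (nths vs (- I)) = length vs"
proof -
  have "length (nths vs I) + length (nths vs (- I))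
      = card ({i. i < length vs \<and> i \<in> I} \<union> {i. i < length vs \<and> i \<in> - I})"
    unfolding length_nths by (rule card_Un_disjoint[symmetric]) auto
  also have "{i. i < length vs \<and> i \<in> I} \<union> {i. i < length vs \<and> i \<in> - I} = {..<length vs}"
    by auto
  finally show ?thesis by simp
qed

lemma grade_involution_wedge:
  fixes a b :: "'a covec"
  shows "grade_involution (wedge a b) = wedge (grade_involution a) (grade_involution b)"
proof
  fix vs :: "'a list"
  have sign: "(-1) ^ length vs =
      (-1 :: real) ^ length (nths vs I) * (-1) ^ length (nths vs (- I))" for I
    by (simp flip: power_add add: length_nths_Compl)
  show "grade_involution (wedge a b) vs = wedge (grade_involution a) (grade_involution b) vs"
    unfolding grade_involution_def wedge_def sum_distrib_left
    by (rule sum.cong[OF refl], subst sign) (simp only: mult_ac)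
qed

abbreviation inversions :: "nat \<Rightarrow> nat set \<Rightarrow> (nat \<times> nat) set" where
  "inversions n I \<equiv> {(i, j). i \<in> I \<and> j \<in> {..<n} - I \<and> j < i}"

text \<open>Splits the shuffles of \<open>X # vs\<close> by whether \<open>X\<close>, at position 0,
  goes to the first factor or to the second.\<close>

lemma Pow_lessThan_Suc:
  "Pow {..<Suc n} = (\<lambda>J. insert 0 (Suc ` J)) ` Pow {..<n} \<union> (\<lambda>J. Suc ` J) ` Pow {..<n}"
  by (simp add: lessThan_Suc_eq_insert_0 Pow_insert image_Pow_surj[symmetric] image_image Un_commute)

text \<open>With 0 in the set, no pair involves position 0: nothing lies below it, and it is not in
  the complement. The other pairs are merely shifted.\<close>

lemma card_inversions_insert_0:
  "card (inversions (Suc n) (insert 0 (Suc ` J))) = card (inversions n J)"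
proof -
  have "(i, j) \<in> inversions (Suc n) (insert 0 (Suc ` J)) \<longleftrightarrow>
      (i, j) \<in> map_prod Suc Suc ` inversions n J" for i j
    by (cases i; cases j) (auto simp: image_iff)
  then have "inversions (Suc n) (insert 0 (Suc ` J)) = map_prod Suc Suc ` inversions n J" by auto
  then show ?thesis
    by (simp add: card_image inj_on_def)
qed

lemma card_inversions_Suc:
  assumes "J \<subseteq> {..<n}"
  shows "card (inversions (Suc n) (Suc ` J)) = card J + card (inversions n J)"
proof -
  have fin: "finite J" using assms finite_subset by blast
  have "(i, j) \<in> inversions (Suc n) (Suc ` J) \<longleftrightarrow>
        (i, j) \<in> (\<lambda>i. (Suc i, 0)) ` J \<union> map_prod Suc Suc ` inversions n J" for i j
    by (cases i; cases j) (auto simp: image_iff)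
  then have eq: "inversions (Suc n) (Suc ` J)
      = (\<lambda>i. (Suc i, 0)) ` J \<union> map_prod Suc Suc ` inversions n J" by auto
  have "finite (inversions n J)"
    by (rule finite_subset[of _ "J \<times> {..<n}"]) (use fin in auto)
  then show ?thesis
    unfolding eq using fin by (subst card_Un_disjoint) (auto simp: card_image inj_on_def)
qed

lemma interior_product_wedge:
  fixes a b :: "'a covec"
  shows "interior_product X (wedge a b) =
     (\<lambda>vs. wedge (interior_product X a) b vs + wedge (grade_involution a) (interior_product X b) vs)"
proof
  fix vs :: "'a list"
  let ?n = "length vs"
  let ?t = "\<lambda>I. (-1) ^ card (inversions (Suc ?n) I) * a (nths (X # vs) I) * b (nths (X # vs) (- I))"
  \<comment> \<open>\<open>nths_Cons\<close> replaces the index set by its preimage under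
    \<open>Suc\<close>.\<close>
  have Suc_pre: "{j. Suc j \<in> Suc ` J} = J" "{j. j \<in> J} = J" for J by auto
  have "interior_product X (wedge a b) vs = sum ?t (Pow {..<Suc ?n})"
    by (simp add: interior_product_def wedge_def)
  also have "\<dots> = sum ?t ((\<lambda>J. insert 0 (Suc ` J)) ` Pow {..<?n})
                + sum ?t ((\<lambda>J. Suc ` J) ` Pow {..<?n})"
    unfolding Pow_lessThan_Suc by (rule sum.union_disjoint) auto
  also have "sum ?t ((\<lambda>J. insert 0 (Suc ` J)) ` Pow {..<?n})
      = (\<Sum>J\<in>Pow {..<?n}. ?t (insert 0 (Suc ` J)))"
    by (rule sum.reindex_cong[OF _ refl refl]) (auto simp: inj_on_def)
  also have "\<dots> = wedge (interior_product X a) b vs"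
    unfolding wedge_def interior_product_def
  proof (rule sum.cong[OF refl])
    fix J assume "J \<in> Pow {..<?n}"
    show "?t (insert 0 (Suc ` J))
        = (-1) ^ card (inversions ?n J) * a (X # nths vs J) * b (nths vs (- J))"
      unfolding card_inversions_insert_0
      by (simp add: nths_Cons Suc_pre Collect_neg_eq[symmetric] Compl_eq) (simp add: image_iff)
  qed
  also have "sum ?t ((\<lambda>J. Suc ` J) ` Pow {..<?n}) = (\<Sum>J\<in>Pow {..<?n}. ?t (Suc ` J))"
    by (rule sum.reindex_cong[OF _ refl refl]) (auto simp: inj_on_def)
  also have "\<dots> = wedge (grade_involution a) (interior_product X b) vs"
    unfolding wedge_def interior_product_def grade_involution_def
  proof (rule sum.cong[OF refl])
    fix J assume J: "J \<in> Pow {..<?n}"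
    then have "{i. i < ?n \<and> i \<in> J} = J" by auto
    \<comment> \<open>The extra \<open>card J\<close> inversions become the degree of the first
      factor, that is, the exponent in \<open>grade_involution\<close>.\<close>
    then have len: "length (nths vs J) = card J" by (simp add: length_nths)
    have "card (inversions (Suc ?n) (Suc ` J)) = card J + card (inversions ?n J)"
      using J by (intro card_inversions_Suc) auto
    then show "?t (Suc ` J) = (-1) ^ card (inversions ?n J) *
        ((-1) ^ length (nths vs J) * a (nths vs J)) * b (X # nths vs (- J))"
      unfolding len
      by (simp add: nths_Cons Suc_pre power_add Compl_eq) (simp add: image_iff)
  qed
  finally show "interior_product X (wedge a b) vs = wedge (interior_product X a) b vs
      + wedge (grade_involution a) (interior_product X b) vs" .
qed

section \<open>Closure properties and low-degree parts of fibre ideals\<close>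

definition scalar_covec :: "real \<Rightarrow> 'a covec" where
  "scalar_covec c = (\<lambda>vs. if vs = [] then c else 0)"

lemma alternating_form_scalar_covec: "alternating_form (scalar_covec c)"
  by (auto simp: alternating_form_def scalar_covec_def linear_iff)

lemma wedge_scalar_covec:
  fixes a :: "'a covec"
  shows "wedge (scalar_covec c) a = (\<lambda>vs. c * a vs)"
proof
  fix vs :: "'a list"
  \<comment> \<open>A nonempty set of positions hands the scalar a nonempty list, where it vanishes;
    only the empty shuffle survives.\<close>
  have "nths vs I \<noteq> []" if "I \<in> Pow {..<length vs} - {{}}" for I
    using that by (auto simp: set_nths simp flip: set_empty)
  then have "wedge (scalar_covec c) a vs = (\<Sum>I\<in>{{}}. (-1) ^ card (inversions (length vs) I) *
        scalar_covec c (nths vs I) * a (nths vs (- I)))"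
    unfolding wedge_def by (intro sum.mono_neutral_right) (auto simp: scalar_covec_def)
  then show "wedge (scalar_covec c) a vs = c * a vs"
    by (simp add: scalar_covec_def nths_all)
qed

text \<open>Scaling is not among the rules of the ideal, but it is the wedge with an element of
  degree 0.\<close>

lemma covec_ideal_scale:
  "a \<in> covec_ideal G \<Longrightarrow> (\<lambda>vs. c * a vs) \<in> covec_ideal G"
  using covec_ideal.wedge_left[OF alternating_form_scalar_covec]
  by (simp add: wedge_scalar_covec)

lemma covec_ideal_grade_involution_homogeneous:
  assumes "a \<in> covec_ideal G" "\<And>vs. length vs \<noteq> k \<Longrightarrow> a vs = 0"
  shows "grade_involution a \<in> covec_ideal G"
proof -
  have "grade_involution a = (\<lambda>vs. (-1) ^ k * a vs)"
    using assms(2) by (force simp: grade_involution_def)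
  then show ?thesis using covec_ideal_scale[OF assms(1)] by simp
qed

lemma covec_ideal_grade_involution:
  assumes "\<And>g. g \<in> G \<Longrightarrow> grade_involution g \<in> covec_ideal G" and "a \<in> covec_ideal G"
  shows "grade_involution a \<in> covec_ideal G"
  using assms(2)
proof induction
  case zero
  then show ?case using covec_ideal.zero by (simp add: grade_involution_def)
next
  case (add a b)
  then show ?case using covec_ideal.add by (fastforce simp: grade_involution_def algebra_simps)
qed (auto simp: grade_involution_wedge assms(1) alternating_form_grade_involution
      intro: covec_ideal.intros)

text \<open>Induction by the antiderivation rule reduces stability to the generators. The condition
  \<open>inv\<close> serves products with the ideal element on the left, since contraction applies
  \<open>grade_involution\<close> to that element.\<close>

lemma covec_ideal_interior_product:
  assumes inv: "\<And>g. g \<in> G \<Longrightarrow> grade_involution g \<in> covec_ideal G"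
    and int: "\<And>g. g \<in> G \<Longrightarrow> interior_product X g \<in> covec_ideal G"
    and "a \<in> covec_ideal G"
  shows "interior_product X a \<in> covec_ideal G"
  using assms(3)
proof induction
  case zero
  then show ?case using covec_ideal.zero by (simp add: interior_product_def)
next
  case (add a b)
  then show ?case using covec_ideal.add by (fastforce simp: interior_product_def)
next
  case (wedge_left b a)
  then show ?case
    unfolding interior_product_wedge
    by (intro covec_ideal.add covec_ideal.wedge_left alternating_form_interior_product
        alternating_form_grade_involution)
next
  case (wedge_right b a)
  then show ?case
    unfolding interior_product_wedge
    by (auto intro!: covec_ideal.add covec_ideal.wedge_right alternating_form_interior_product
        covec_ideal_grade_involution[OF inv])
qed (rule int)

lemma wedge_Nil: "wedge a b [] = a [] * b []"
  by (simp add: wedge_def)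

lemma wedge_single: "wedge a b [v] = a [] * b [v] + a [v] * b []"
proof -
  have "Pow {..<length [v]} = {{}, {0}}" by (auto simp: lessThan_Suc)
  then have "wedge a b [v] = (\<Sum>I\<in>{{}, {0}}. (-1) ^ card (inversions 1 I) *
      a (nths [v] I) * b (nths [v] (- I)))"
    unfolding wedge_def by simp
  moreover have "inversions 1 {} = {}" "inversions 1 {0} = {}" by auto
  then have "card (inversions 1 {}) = 0" "card (inversions 1 {0}) = 0"
    by (simp_all only: card.empty)
  ultimately show ?thesis
    by (simp only: sum.insert) (simp add: nths_Cons)
qed

lemma covec_ideal_low_degree_vanishing:
  assumes "a \<in> covec_ideal G" "\<And>g. g \<in> G \<Longrightarrow> g [] = 0"
  shows "a [] = 0" and "(\<And>g. g \<in> G \<Longrightarrow> g [v] = 0) \<Longrightarrow> a [v] = 0"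
proof -
  show Nil: "a [] = 0"
    using assms by induction (auto simp: wedge_Nil)
  \<comment> \<open>The degree-0 claim is carried along: by \<open>wedge_single\<close>, the
    degree-1 part of a product also pairs the degree-0 part of the ideal element with the degree-1
    part of the coefficient.\<close>
  have "a [] = 0 \<and> a [v] = 0" if "\<And>g. g \<in> G \<Longrightarrow> g [v] = 0"
    using assms(1) by induction (auto simp: wedge_Nil wedge_single assms(2) that)
  then show "(\<And>g. g \<in> G \<Longrightarrow> g [v] = 0) \<Longrightarrow> a [v] = 0" by blast
qed

section \<open>The generators and their exterior derivatives in coordinates\<close>

lemma ext_d_homogeneous:
  assumes "\<And>y vs. length vs \<noteq> k \<Longrightarrow> \<omega> y vs = 0" "length vs \<noteq> Suc k"
  shows "ext_d \<omega> m vs = 0"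
proof -
  \<comment> \<open>Deleting one argument leaves a list whose length is not \<open>k\<close>, so
    only the zero function is differentiated.\<close>
  have "(\<lambda>y. \<omega> y (take i vs @ drop (Suc i) vs)) = (\<lambda>y. 0)" if "i < length vs" for i
    using assms that by (intro ext assms(1)) auto
  then show ?thesis by (simp add: ext_d_def frechet_derivative_const)
qed

lemma ext_d_pair:
  "ext_d \<omega> m [v, w] =
     frechet_derivative (\<lambda>y. \<omega> y [w]) (at m) v - frechet_derivative (\<lambda>y. \<omega> y [v]) (at m) w"
  by (simp add: ext_d_def numeral_2_eq_2)

lemma dfun_single: "dfun f m [v] = frechet_derivative f (at m) v"
  by (simp add: ext_d_def fun_form_def)

lemma dfun_homogeneous: "length vs \<noteq> Suc 0 \<Longrightarrow> dfun f m vs = 0"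
  by (rule ext_d_homogeneous[of 0]) (auto simp: fun_form_def)

lemma dfun_has_derivative:
  assumes "(f has_derivative f') (at m)"
  shows "dfun f m [v] = f' v"
  by (simp add: dfun_single frechet_derivative_at[OF assms, symmetric])

lemma dfun_coord: "dfun (\<lambda>m :: real ^ 'n. m $ i) m [v] = v $ i"
  by (rule dfun_has_derivative)
    (intro bounded_linear_imp_has_derivative bounded_linear_vec_nth)

lemma omega0_homogeneous: "length vs \<noteq> Suc 0 \<Longrightarrow> omega0 m vs = 0"
  by (simp add: omega0_def dfun_homogeneous)

lemma omega0_single: "omega0 m [v] = Z_coord v - P_coord m * X_coord v - Q_coord m * Y_coord v"
  by (simp add: omega0_def dfun_coord)

lemma Psi_homogeneous: "length vs \<noteq> Suc 0 \<Longrightarrow> Psi \<alpha> m vs = 0"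
  by (simp add: Psi_def dfun_homogeneous)

lemma Psi_single: "Psi \<alpha> m [v] = P_coord v - \<alpha> m * Q_coord v"
  by (simp add: Psi_def dfun_coord)

lemma ext_d_omega0_pair:
  "ext_d omega0 m [v, w] =
     X_coord v * P_coord w - P_coord v * X_coord w + Y_coord v * Q_coord w - Q_coord v * Y_coord w"
proof -
  have "((\<lambda>y. omega0 y [w]) has_derivative
      (\<lambda>v. - (P_coord v * X_coord w) - Q_coord v * Y_coord w)) (at m)" for w
    unfolding omega0_single
    by (auto intro!: derivative_eq_intros bounded_linear_imp_has_derivative bounded_linear_vec_nth)
  note D = frechet_derivative_at[OF this, symmetric]
  show ?thesis
    by (simp add: ext_d_pair D)
qed

lemma ext_d_Psi_pair:
  assumes "\<alpha> differentiable (at m)"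
  shows "ext_d (Psi \<alpha>) m [v, w] =
     frechet_derivative \<alpha> (at m) w * Q_coord v - frechet_derivative \<alpha> (at m) v * Q_coord w"
proof -
  have "((\<lambda>y. Psi \<alpha> y [w]) has_derivative
      (\<lambda>v. - (frechet_derivative \<alpha> (at m) v * Q_coord w))) (at m)" for w
    unfolding Psi_single
    using assms[unfolded frechet_derivative_works]
    by (auto intro!: derivative_eq_intros)
  note D = frechet_derivative_at[OF this, symmetric]
  show ?thesis
    by (simp add: ext_d_pair D)
qed

definition coord_vec :: "real \<Rightarrow> real \<Rightarrow> real \<Rightarrow> real \<Rightarrow> real \<Rightarrow> real ^ 5" where
  "coord_vec a b c d e = (\<chi> i. if i = 1 then a else if i = 2 then b else if i = 3 then c
     else if i = 4 then d else e)"

lemma coord_vec_nth: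
  "coord_vec a b c d e $ 1 = a" "coord_vec a b c d e $ 2 = b" "coord_vec a b c d e $ 3 = c"
  "coord_vec a b c d e $ 4 = d" "coord_vec a b c d e $ 5 = e"
  by (simp_all add: coord_vec_def)

lemma smooth_on_differentiable:
  "smooth_on U f \<Longrightarrow> m \<in> U \<Longrightarrow> f differentiable (at m)"
  unfolding smooth_on_def by (metis Ck_on.simps(2))

section \<open>The Cauchy characteristic system at a point\<close>

context
  fixes U :: "(real ^ 5) set" and \<alpha> :: "real ^ 5 \<Rightarrow> real" and m :: "real ^ 5"
  assumes m: "m \<in> U" and smooth: "smooth_on U \<alpha>" and invol: "involutive_type U \<alpha>"
begin

lemma differentiable: "\<alpha> differentiable (at m)"
  using smooth m by (rule smooth_on_differentiable)

text \<open>In the expansion by partial derivatives, involutivity eliminates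
  \<open>D_x \<alpha> m\<close> and the contact condition eliminates the z-component; the terms in
  \<open>P_coord m * D_z \<alpha> m\<close> then cancel.\<close>

lemma derivative_on_contact_vector:
  assumes "P_coord X = 0" "Q_coord X = 0"
    "Z_coord X = P_coord m * X_coord X + Q_coord m * Y_coord X"
  shows "frechet_derivative \<alpha> (at m) X =
     (D_y \<alpha> m + Q_coord m * D_z \<alpha> m) * (\<alpha> m * X_coord X + Y_coord X)"
proof -
  have D_x: "D_x \<alpha> m = \<alpha> m * (D_y \<alpha> m + Q_coord m * D_z \<alpha> m) - P_coord m * D_z \<alpha> m"
    using invol m by (force simp: involutive_type_def)
  show ?thesis
    unfolding frechet_derivative_partial_expansion[OF differentiable] sum_5 assms D_x
    by (simp add: algebra_simps)
qed

lemma Ch_at_diff_ideal: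
  "Ch_at (diff_ideal U {omega0, Psi \<alpha>}) m =
     {X. P_coord X = 0 \<and> Q_coord X = 0 \<and> \<alpha> m * X_coord X + Y_coord X = 0 \<and>
         Z_coord X = P_coord m * X_coord X + Q_coord m * Y_coord X}"
  (is "_ = ?K")
proof -
  define G where "G = {omega0 m, Psi \<alpha> m, ext_d omega0 m, ext_d (Psi \<alpha>) m}"
  have Ch: "Ch_at (diff_ideal U {omega0, Psi \<alpha>}) m
      = {X. \<forall>a\<in>covec_ideal G. interior_product X a \<in> covec_ideal G}"
    unfolding Ch_at_def diff_ideal_def values_at_alg_ideal[OF m]
    by (auto simp: values_at_def G_def insert_commute)
  have hom: "length vs \<noteq> Suc 0 \<Longrightarrow> omega0 m vs = 0" "length vs \<noteq> Suc 0 \<Longrightarrow> Psi \<alpha> m vs = 0"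
    "length vs \<noteq> 2 \<Longrightarrow> ext_d omega0 m vs = 0" "length vs \<noteq> 2 \<Longrightarrow> ext_d (Psi \<alpha>) m vs = 0" for vs
    by (auto simp: omega0_homogeneous Psi_homogeneous
        intro!: ext_d_homogeneous[where k = 1])
  have G: "omega0 m \<in> covec_ideal G" "Psi \<alpha> m \<in> covec_ideal G"
    "ext_d omega0 m \<in> covec_ideal G" "ext_d (Psi \<alpha>) m \<in> covec_ideal G"
    by (auto simp: G_def intro: covec_ideal.generator)
  have Nil: "g [] = 0" if "g \<in> G" for g
    using that hom by (auto simp: G_def)
  have characteristic: "X \<in> ?K"
    if X: "\<And>a. a \<in> covec_ideal G \<Longrightarrow> interior_product X a \<in> covec_ideal G" for X
  proof -
    \<comment> \<open>The degree-0 parts of these contractions are the values of the two 1-forms on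
      \<open>X\<close>.\<close>
    have "interior_product X (omega0 m) [] = 0" "interior_product X (Psi \<alpha> m) [] = 0"
      by (rule covec_ideal_low_degree_vanishing(1)[OF X], rule G, erule Nil)+
    moreover have "ext_d omega0 m [X, v] = 0" if "omega0 m [v] = 0" "Psi \<alpha> m [v] = 0" for v
    proof -
      have single: "g [v] = 0" if "g \<in> G" for g
        using that hom \<open>omega0 m [v] = 0\<close> \<open>Psi \<alpha> m [v] = 0\<close> by (auto simp: G_def)
      have "interior_product X (ext_d omega0 m) [v] = 0"
        by (rule covec_ideal_low_degree_vanishing(2)[OF X[OF G(3)]], erule Nil, erule single)
      then show ?thesis by (simp add: interior_product_def)
    qed
    \<comment> \<open>These three vectors form a basis of the common kernel of
      \<open>omega0 m\<close> and \<open>Psi \<alpha> m\<close>; each yields one equation on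
      \<open>X\<close>.\<close>
    from this[of "coord_vec 1 0 (P_coord m) 0 0"] this[of "coord_vec 0 1 (Q_coord m) 0 0"]
      this[of "coord_vec 0 0 0 (\<alpha> m) 1"]
    have "P_coord X = 0" "Q_coord X = 0" "X_coord X * \<alpha> m + Y_coord X = 0"
      by (simp_all add: omega0_single Psi_single ext_d_omega0_pair coord_vec_nth)
    ultimately show ?thesis
      by (simp add: interior_product_def omega0_single mult.commute)
  qed
  have stable: "interior_product X a \<in> covec_ideal G"
    if X: "X \<in> ?K" and a: "a \<in> covec_ideal G" for X a
  proof (rule covec_ideal_interior_product[OF _ _ a])
    show "grade_involution g \<in> covec_ideal G" if "g \<in> G" for g
      using that covec_ideal_grade_involution_homogeneous[OF G(1) hom(1)]
        covec_ideal_grade_involution_homogeneous[OF G(2) hom(2)]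
        covec_ideal_grade_involution_homogeneous[OF G(3) hom(3)]
        covec_ideal_grade_involution_homogeneous[OF G(4) hom(4)]
      unfolding G_def by auto
  next
    fix g assume "g \<in> G"
    \<comment> \<open>A covector here is a function on lists of every length, so equality of 1-forms
      must also be checked off degree 1.\<close>
    have one_form_eqI: "a = b"
      if "\<And>vs. length vs \<noteq> Suc 0 \<Longrightarrow> a vs = 0" "\<And>vs. length vs \<noteq> Suc 0 \<Longrightarrow> b vs = 0"
        "\<And>v. a [v] = b [v]" for a b :: "(real ^ 5) covec"
    proof
      fix vs show "a vs = b vs"
        using that by (cases "length vs = Suc 0") (auto simp: length_Suc_conv)
    qed
    have "interior_product X (omega0 m) = (\<lambda>vs. 0)" "interior_product X (Psi \<alpha> m) = (\<lambda>vs. 0)"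
    proof -
      have "omega0 m (X # vs) = 0" "Psi \<alpha> m (X # vs) = 0" for vs
        using X hom by (cases vs; simp add: omega0_single Psi_single)+
      then show "interior_product X (omega0 m) = (\<lambda>vs. 0)" "interior_product X (Psi \<alpha> m) = (\<lambda>vs. 0)"
        by (auto simp: interior_product_def)
    qed
    moreover have "interior_product X (ext_d omega0 m) = (\<lambda>vs. X_coord X * Psi \<alpha> m vs)"
    proof (rule one_form_eqI)
      \<comment> \<open>As dp and dq vanish on \<open>X\<close>, the contraction is
        dx(\<open>X\<close>) dp + dy(\<open>X\<close>) dq; substituting dy(\<open>X\<close>) turns
        it into a multiple of \<open>Psi \<alpha> m\<close>.\<close>
      have "Y_coord X = - \<alpha> m * X_coord X" using X by simp
      then show "interior_product X (ext_d omega0 m) [v] = X_coord X * Psi \<alpha> m [v]" for v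
        using X by (simp add: interior_product_def ext_d_omega0_pair Psi_single algebra_simps)
    qed (simp_all add: interior_product_def hom)
    moreover have "interior_product X (ext_d (Psi \<alpha>) m) = (\<lambda>vs. 0)"
    proof (rule one_form_eqI)
      show "interior_product X (ext_d (Psi \<alpha>) m) [v] = 0" for v
        using X by (simp add: interior_product_def ext_d_Psi_pair[OF differentiable]
            derivative_on_contact_vector)
    qed (simp_all add: interior_product_def hom)
    ultimately show "interior_product X g \<in> covec_ideal G"
      using \<open>g \<in> G\<close> covec_ideal_scale[OF G(2)] covec_ideal.zero unfolding G_def by auto
  qed
  show ?thesis
    unfolding Ch
  proof (intro Set.equalityI subsetI)
    fix X
    assume "X \<in> {X. \<forall>a\<in>covec_ideal G. interior_product X a \<in> covec_ideal G}"
    then show "X \<in> ?K" by (intro characteristic) simp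
  next
    fix X
    assume "X \<in> ?K"
    then show "X \<in> {X. \<forall>a\<in>covec_ideal G. interior_product X a \<in> covec_ideal G}"
      using stable[of X] by blast
  qed
qed

text \<open>Common form of both cases: only the first integral \<open>f\<close> and its factor
  \<open>c\<close> differ. Since dg is \<open>omega0\<close> - x dp - y dq, the conditions dg = dp =
  dq = 0 say \<open>omega0\<close> = dp = dq = 0; there df is \<open>c\<close> times the last
  equation of \<open>Ch_at_diff_ideal\<close>.\<close>

lemma Ch_at_eq_annihilated_at:
  fixes f :: "real ^ 5 \<Rightarrow> real"
  defines "g \<equiv> \<lambda>m. Z_coord m - P_coord m * X_coord m - Q_coord m * Y_coord m"
  assumes f: "f differentiable (at m)" and "c \<noteq> 0"
    and fX: "\<And>X. P_coord X = 0 \<Longrightarrow> Q_coord X = 0 \<Longrightarrow>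
      Z_coord X = P_coord m * X_coord X + Q_coord m * Y_coord X \<Longrightarrow>
      dfun f m [X] = c * (\<alpha> m * X_coord X + Y_coord X)"
  shows "Ch_at (diff_ideal U {omega0, Psi \<alpha>}) m
           = annihilated_at {dfun f, dfun g, dfun P_coord, dfun Q_coord} m \<and>
         independent_first_integrals_at (diff_ideal U {omega0, Psi \<alpha>}) m [f, g, P_coord, Q_coord]"
proof -
  have g: "dfun g m [X] = Z_coord X - P_coord m * X_coord X - Q_coord m * Y_coord X
      - X_coord m * P_coord X - Y_coord m * Q_coord X" for X
    unfolding g_def
    by (rule dfun_has_derivative)
      (auto intro!: derivative_eq_intros bounded_linear_imp_has_derivative bounded_linear_vec_nth
        simp: algebra_simps)
  have eq: "Ch_at (diff_ideal U {omega0, Psi \<alpha>}) m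
      = annihilated_at {dfun f, dfun g, dfun P_coord, dfun Q_coord} m"
    unfolding Ch_at_diff_ideal annihilated_at_def
    using \<open>c \<noteq> 0\<close> by (auto simp: dfun_coord g fX)
  have "independent_at m [f, g, P_coord, Q_coord]"
    unfolding independent_at_def
  proof (intro allI impI)
    fix a :: "nat \<Rightarrow> real" and i
    assume "\<forall>X. (\<Sum>i<length [f, g, P_coord, Q_coord].
        a i * dfun ([f, g, P_coord, Q_coord] ! i) m [X]) = 0"
      and i: "i < length [f, g, P_coord, Q_coord]"
    then have sum: "a 0 * dfun f m [X] + a 1 * dfun g m [X] + a 2 * P_coord X + a 3 * Q_coord X = 0"
      for X
      by (simp add: dfun_coord numeral_eq_Suc add.assoc)
    \<comment> \<open>The system is triangular: the first test vector kills dg, dp and dq while df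
      takes the value \<open>c\<close> on it; the vectors along z, p and q then isolate the
      remaining coefficients in turn.\<close>
    have "a 0 = 0"
      using sum[of "coord_vec 0 1 (Q_coord m) 0 0"] \<open>c \<noteq> 0\<close>
      by (simp add: g fX coord_vec_nth)
    moreover from this have "a 1 = 0"
      using sum[of "coord_vec 0 0 1 0 0"] by (simp add: g coord_vec_nth)
    moreover from calculation have "a 2 = 0" "a 3 = 0"
      using sum[of "coord_vec 0 0 0 1 0"] sum[of "coord_vec 0 0 0 0 1"]
      by (simp_all add: coord_vec_nth)
    moreover from i have "i = 0 \<or> i = 1 \<or> i = 2 \<or> i = 3" by auto
    ultimately show "a i = 0" by auto
  qed
  then show ?thesis
    \<comment> \<open>By \<open>eq\<close>, every characteristic vector is annihilated by the four
      differentials, so the first-integral property is immediate.\<close>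
    unfolding independent_first_integrals_at_def first_integral_at_def eq
    by (auto simp: annihilated_at_def)
qed

end

section \<open>The two choices of first integrals\<close>

theorem proposition4p6:
  fixes U :: "(real ^ 5) set" and \<alpha> :: "real ^ 5 \<Rightarrow> real" and p0 :: "real ^ 5"
  assumes "open U"
    and "smooth_on U \<alpha>"
    and "involutive_type U \<alpha>"
    and "p0 \<in> U"
  shows
    "(1 + X_coord p0 * (D_y \<alpha> p0 + Q_coord p0 * D_z \<alpha> p0) \<noteq> 0 \<longrightarrow>
        Ch_at (diff_ideal U {omega0, Psi \<alpha>}) p0 =
          annihilated_at {dfun (\<lambda>m. Y_coord m + \<alpha> m * X_coord m),
                          dfun (\<lambda>m. Z_coord m - P_coord m * X_coord m - Q_coord m * Y_coord m),
                          dfun P_coord, dfun Q_coord} p0 \<and>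
        independent_first_integrals_at (diff_ideal U {omega0, Psi \<alpha>}) p0
          [\<lambda>m. Y_coord m + \<alpha> m * X_coord m,
           \<lambda>m. Z_coord m - P_coord m * X_coord m - Q_coord m * Y_coord m,
           P_coord, Q_coord]) \<and>
     (1 + X_coord p0 * (D_y \<alpha> p0 + Q_coord p0 * D_z \<alpha> p0) = 0 \<longrightarrow>
        Ch_at (diff_ideal U {omega0, Psi \<alpha>}) p0 =
          annihilated_at {dfun \<alpha>,
                          dfun (\<lambda>m. Z_coord m - P_coord m * X_coord m - Q_coord m * Y_coord m),
                          dfun P_coord, dfun Q_coord} p0 \<and>
        independent_first_integrals_at (diff_ideal U {omega0, Psi \<alpha>}) p0
          [\<alpha>,
           \<lambda>m. Z_coord m - P_coord m * X_coord m - Q_coord m * Y_coord m,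
           P_coord, Q_coord])"
proof -
  let ?B = "D_y \<alpha> p0 + Q_coord p0 * D_z \<alpha> p0"
  have \<alpha>: "\<alpha> differentiable (at p0)"
    using assms by (auto intro: smooth_on_differentiable)
  note main = Ch_at_eq_annihilated_at[OF \<open>p0 \<in> U\<close> \<open>smooth_on U \<alpha>\<close> \<open>involutive_type U \<alpha>\<close>]
  note on_contact =
    derivative_on_contact_vector[OF \<open>p0 \<in> U\<close> \<open>smooth_on U \<alpha>\<close> \<open>involutive_type U \<alpha>\<close>]
  have D: "((\<lambda>m. Y_coord m + \<alpha> m * X_coord m) has_derivative (\<lambda>X. Y_coord X +
      (\<alpha> p0 * X_coord X + frechet_derivative \<alpha> (at p0) X * X_coord p0))) (at p0)"
    using \<alpha>[unfolded frechet_derivative_works]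
    by (auto intro!: derivative_eq_intros bounded_linear_imp_has_derivative bounded_linear_vec_nth)
  have diff: "(\<lambda>m. Y_coord m + \<alpha> m * X_coord m) differentiable (at p0)"
    using D by (auto simp: differentiable_def)
  have fX: "dfun (\<lambda>m. Y_coord m + \<alpha> m * X_coord m) p0 [X]
      = (1 + X_coord p0 * ?B) * (\<alpha> p0 * X_coord X + Y_coord X)"
    if "P_coord X = 0" "Q_coord X = 0"
      "Z_coord X = P_coord p0 * X_coord X + Q_coord p0 * Y_coord X" for X
    unfolding dfun_has_derivative[OF D] on_contact[OF that] by (simp add: algebra_simps)
  have \<alpha>X: "dfun \<alpha> p0 [X] = ?B * (\<alpha> p0 * X_coord X + Y_coord X)"
    if "P_coord X = 0" "Q_coord X = 0"
      "Z_coord X = P_coord p0 * X_coord X + Q_coord p0 * Y_coord X" for X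
    unfolding dfun_single by (rule on_contact[OF that])
  show ?thesis
  proof (rule conjI; rule impI)
    assume "1 + X_coord p0 * ?B = 0"
    \<comment> \<open>If \<open>?B\<close> were 0, the assumption would read 1 = 0; hence
      \<open>?B\<close> can serve as the factor \<open>c\<close> for
      \<open>\<alpha>\<close>.\<close>
    then have "?B \<noteq> 0" by auto
    then show "Ch_at (diff_ideal U {omega0, Psi \<alpha>}) p0 =
          annihilated_at {dfun \<alpha>,
                          dfun (\<lambda>m. Z_coord m - P_coord m * X_coord m - Q_coord m * Y_coord m),
                          dfun P_coord, dfun Q_coord} p0 \<and>
        independent_first_integrals_at (diff_ideal U {omega0, Psi \<alpha>}) p0
          [\<alpha>,
           \<lambda>m. Z_coord m - P_coord m * X_coord m - Q_coord m * Y_coord m,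
           P_coord, Q_coord]"
      by (rule main[OF \<alpha> _ \<alpha>X])
  \<comment> \<open>In the remaining case the factor is \<open>1 + X_coord p0 * ?B\<close>, nonzero
    by the hypothesis of that case.\<close>
  qed (rule main[OF diff _ fX])
qed

end
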